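(* Let $\mathcal H$ be a finite-dimensional complex Hilbert space and let $S\subset\mathbb B(\mathcal H)$ be a set of self-adjoint elements. Then $\overline{\mathrm{Channel}^*(S)}$ consists of unital channels (i.e. every $\Phi$ in it satisfies $\Phi(I)=I$). In particular, $\overline{\mathrm{Channel}^*(S)}$ is not transitive.
   Context: $\mathbb B(\mathcal H)$ is the algebra of linear operators on $\mathcal H$, $I$ is the identity operator, and $\mathcal D(\mathcal H)=\{\rho\in\mathbb B(\mathcal H):\rho=\rho^*,\ \rho\ge 0,\ \mathrm{tr}\,\rho=1\}$ is the set of density matrices. A channel is a completely positive trace-preserving map on $\mathbb B(\mathcal H)$. Spans are complex linear spans. For $a\in\mathbb B(\mathcal H)$ let $L_a(\rho)=2a\rho a^*-a^*a\rho-\rho a^*a$. $\overline{\mathrm{Channel}^*(S)}$ is the class of evolutions on $\mathbb B(\mathcal H)$ generated by $S$ under the following rules (the smallest class satisfying all of them): (UN) if $iH\in\mathrm{span}(S)$ is anti-Hermitian, then $\rho\mapsto e^{itH}\rho e^{-itH}$ belongs to the class for all $t\ge 0$; (JU) for every $a\in S$ and $t\ge 0$, $e^{tL_a}$ belongs to the class; (CO) the class is closed under composition; (CL) the class is topologically closed; (CV) the class is convex. A set $\mathcal O$ of operations is transitive if $\mathcal D(\mathcal H)$ is controllable under it: for all $\rho,\sigma\in\mathcal D(\mathcal H)$ there is $\Phi\in\mathcal O$ with $\Phi(\rho)=\sigma$; in the continuous setting, for all $\rho,\sigma\in\mathcal D(\mathcal H)$ there is $T_t\in\mathcal O$ with $T_\tau(\rho)=\sigma$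 for some $\tau>0$ or in the limit $t\to\infty$.
   Formalization: Non-transitivity is claimed only for dim H ≥ 2: if dim H = 1 there is a single density matrix, which the identity channel in the class fixes, so the class is transitive. The unital-channel claim is for every nonzero finite-dimensional H, taken as C^n. *)

theory Defs
  imports "HOL-Analysis.Analysis"
begin

text \<open>
  The Hilbert space is \<open>complex ^ 'n\<close> with its standard inner product, and \<open>B(H)\<close> is the type
  \<open>complex ^ 'n ^ 'n\<close> of matrices, with product \<open>**\<close> and identity \<open>mat 1\<close> (on this type \<open>*\<close> and
  \<open>1\<close> are the componentwise product and the all-ones matrix). Superoperators are elements of the
  normed space of bounded real-linear maps on \<open>B(H)\<close>; complex linearity is part of the
  definition of a channel below.
\<close>

type_synonym 'n cmat = "complex ^ 'n ^ 'n"
type_synonym 'n superop = "'n cmat \<Rightarrow>\<^sub>L 'n cmat"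

definition cinner :: "complex ^ 'n::finite \<Rightarrow> complex ^ 'n \<Rightarrow> complex"
  where "cinner v w = (\<Sum>i\<in>UNIV. cnj (v $ i) * w $ i)"

definition hadj :: "'n::finite cmat \<Rightarrow> 'n cmat"
  where "hadj A = (\<chi> i j. cnj (A $ j $ i))"

definition cscale :: "complex \<Rightarrow> 'n::finite cmat \<Rightarrow> 'n cmat"
  where "cscale c A = (\<chi> i j. c * A $ i $ j)"

interpretation cmat: vector_space "cscale :: complex \<Rightarrow> 'n::finite cmat \<Rightarrow> 'n cmat"
  by unfold_locales (simp_all add: cscale_def vec_eq_iff algebra_simps)

definition pos_semidef :: "'n::finite cmat \<Rightarrow> bool"
  where "pos_semidef A \<longleftrightarrow> (\<forall>v. cinner v (A *v v) \<in> \<real>\<^sub>\<ge>\<^sub>0)"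

definition density :: "'n::finite cmat set"
  where "density = {\<rho>. hadj \<rho> = \<rho> \<and> pos_semidef \<rho> \<and> trace \<rho> = 1}"

text \<open>
  Positivity of an \<open>m \<times> m\<close> block operator on \<open>\<complex>\<^sup>m \<otimes> H\<close>, whose vectors are the families
  \<open>v 0, \<dots>, v (m - 1)\<close>. Applying \<open>\<Phi>\<close> to each block is \<open>id \<otimes> \<Phi>\<close>.
\<close>

definition block_pos_semidef :: "nat \<Rightarrow> (nat \<Rightarrow> nat \<Rightarrow> 'n::finite cmat) \<Rightarrow> bool"
  where "block_pos_semidef m X \<longleftrightarrow>
    (\<forall>v. (\<Sum>i<m. \<Sum>j<m. cinner (v i) (X i j *v v j)) \<in> \<real>\<^sub>\<ge>\<^sub>0)"

definition completely_positive :: "'n::finite superop \<Rightarrow> bool"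
  where "completely_positive \<Phi> \<longleftrightarrow>
    (\<forall>m X. block_pos_semidef m X \<longrightarrow> block_pos_semidef m (\<lambda>i j. blinfun_apply \<Phi> (X i j)))"

definition channel :: "'n::finite superop \<Rightarrow> bool"
  where "channel \<Phi> \<longleftrightarrow>
    (\<forall>c A. blinfun_apply \<Phi> (cscale c A) = cscale c (blinfun_apply \<Phi> A)) \<and>
    completely_positive \<Phi> \<and>
    (\<forall>A. trace (blinfun_apply \<Phi> A) = trace A)"

definition unital :: "'n::finite superop \<Rightarrow> bool"
  where "unital \<Phi> \<longleftrightarrow> blinfun_apply \<Phi> (mat 1) = mat 1"

definition mat_exp :: "'n::finite cmat \<Rightarrow> 'n cmat"
  where "mat_exp A = (\<Sum>k. (1 / fact k) *\<^sub>R ((**) A ^^ k) (mat 1))"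

definition blinfun_exp :: "('a::banach \<Rightarrow>\<^sub>L 'a) \<Rightarrow> 'a \<Rightarrow>\<^sub>L 'a"
  where "blinfun_exp F = (\<Sum>k. (1 / fact k) *\<^sub>R ((o\<^sub>L) F ^^ k) id_blinfun)"

lemma bounded_linear_sandwich:
  "bounded_linear (\<lambda>\<rho> :: 'n::finite cmat. A ** \<rho> ** B)"
proof -
  have "linear (\<lambda>\<rho> :: 'n cmat. A ** \<rho> ** B)"
    by (rule linearI)
      (simp_all add: matrix_matrix_mult_def vec_eq_iff algebra_simps sum.distrib
        sum_distrib_left sum_distrib_right scaleR_sum_right)
  then show ?thesis
    by (simp add: linear_conv_bounded_linear)
qed

lift_definition sandwich :: "'n::finite cmat \<Rightarrow> 'n cmat \<Rightarrow> 'n superop"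
  is "\<lambda>A B \<rho>. A ** \<rho> ** B"
  by (rule bounded_linear_sandwich)

lift_definition lindblad :: "'n::finite cmat \<Rightarrow> 'n superop"
  is "\<lambda>a \<rho>. 2 *\<^sub>R (a ** \<rho> ** hadj a) - hadj a ** a ** \<rho> - \<rho> ** hadj a ** a"
proof -
  fix a :: "'n cmat"
  have "bounded_linear (\<lambda>\<rho>. 2 *\<^sub>R (a ** \<rho> ** hadj a) - (hadj a ** a) ** \<rho> ** mat 1
      - mat 1 ** \<rho> ** (hadj a ** a))"
    by (intro bounded_linear_sub bounded_linear_sandwich
        bounded_linear_compose[OF bounded_linear_scaleR_right])
  then show "bounded_linear (\<lambda>\<rho>. 2 *\<^sub>R (a ** \<rho> ** hadj a) - hadj a ** a ** \<rho> - \<rho> ** hadj a ** a)"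
    by (simp add: matrix_mul_assoc)
qed

text \<open>The exponential series converge, so the sums above are the genuine exponentials.\<close>

lemma summable_blinfun_exp:
  fixes F :: "'a::banach \<Rightarrow>\<^sub>L 'a"
  shows "summable (\<lambda>k. (1 / fact k) *\<^sub>R ((o\<^sub>L) F ^^ k) id_blinfun)"
proof (rule summable_comparison_test')
  show "summable (\<lambda>k. norm F ^ k /\<^sub>R fact k * norm (id_blinfun :: 'a \<Rightarrow>\<^sub>L 'a))"
    by (intro summable_mult2 summable_exp_generic)
  fix k :: nat assume "k \<ge> 0"
  have "norm (((o\<^sub>L) F ^^ k) id_blinfun) \<le> norm F ^ k * norm (id_blinfun :: 'a \<Rightarrow>\<^sub>L 'a)"
  proof (induction k)
    case (Suc k)
    have "norm (F o\<^sub>L ((o\<^sub>L) F ^^ k) id_blinfun) \<le> norm F * norm (((o\<^sub>L) F ^^ k) id_blinfun)"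
      by (rule norm_blinfun_compose)
    also have "\<dots> \<le> norm F * (norm F ^ k * norm (id_blinfun :: 'a \<Rightarrow>\<^sub>L 'a))"
      by (intro mult_left_mono Suc norm_ge_zero)
    finally show ?case by (simp add: mult_ac)
  qed simp
  then show "norm ((1 / fact k) *\<^sub>R ((o\<^sub>L) F ^^ k) id_blinfun)
      \<le> norm F ^ k /\<^sub>R fact k * norm (id_blinfun :: 'a \<Rightarrow>\<^sub>L 'a)"
    by (simp add: divide_simps)
qed

lemma summable_mat_exp:
  fixes A :: "'n::finite cmat"
  shows "summable (\<lambda>k. (1 / fact k) *\<^sub>R ((**) A ^^ k) (mat 1))"
proof -
  have pow: "blinfun_apply (((o\<^sub>L) (sandwich A (mat 1)) ^^ k) id_blinfun) (mat 1) = ((**) A ^^ k) (mat 1)"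
    for k
    by (induction k) (simp_all add: sandwich.rep_eq)
  from summable_blinfun_exp[of "sandwich A (mat 1)"]
  have "summable (\<lambda>k. blinfun_apply
      ((1 / fact k) *\<^sub>R ((o\<^sub>L) (sandwich A (mat 1)) ^^ k) id_blinfun) (mat 1))"
    by (rule bounded_linear.summable[OF blinfun.bounded_linear_left])
  then show ?thesis by (simp add: scaleR_blinfun.rep_eq pow)
qed

definition generation_rules :: "'n::finite cmat set \<Rightarrow> 'n superop set \<Rightarrow> bool"
  where "generation_rules S C \<longleftrightarrow>
    \<comment> \<open>UN\<close>
    (\<forall>H t. cscale \<i> H \<in> cmat.span S \<longrightarrow> hadj (cscale \<i> H) = - cscale \<i> H \<longrightarrow> t \<ge> 0 \<longrightarrow>
      sandwich (mat_exp (cscale (\<i> * of_real t) H)) (mat_exp (cscale (- \<i> * of_real t) H)) \<in> C) \<and>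
    \<comment> \<open>JU\<close>
    (\<forall>a\<in>S. \<forall>t\<ge>0. blinfun_exp (t *\<^sub>R lindblad a) \<in> C) \<and>
    \<comment> \<open>CO\<close>
    (\<forall>\<Phi>\<in>C. \<forall>\<Psi>\<in>C. \<Phi> o\<^sub>L \<Psi> \<in> C) \<and>
    \<comment> \<open>CL\<close>
    closed C \<and>
    \<comment> \<open>CV\<close>
    convex C"

definition Channel_closure :: "'n::finite cmat set \<Rightarrow> 'n superop set"
  where "Channel_closure S = \<Inter>{C. generation_rules S C}"

lemma generation_rules_Channel_closure: "generation_rules S (Channel_closure S)"
proof -
  have "closed (Channel_closure S)" "convex (Channel_closure S)"
    unfolding Channel_closure_def
    by (rule closed_Inter convex_Inter; auto simp: generation_rules_def)+
  then show ?thesis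
    unfolding generation_rules_def by (auto simp: Channel_closure_def generation_rules_def)
qed

definition transitive_ops :: "'n::finite superop set \<Rightarrow> bool"
  where "transitive_ops \<O> \<longleftrightarrow>
    (\<forall>\<rho>\<in>density. \<forall>\<sigma>\<in>density. \<exists>\<Phi>\<in>\<O>. blinfun_apply \<Phi> \<rho> = \<sigma>)"

text \<open>
  Continuous-time version. An evolution is any time-indexed family of members of \<open>\<O>\<close>; neither a
  semigroup law nor continuity in time is required, which makes transitivity as weak, and
  hence its negation as strong, as possible.
\<close>

definition transitive_evolutions :: "'n::finite superop set \<Rightarrow> bool"
  where "transitive_evolutions \<O> \<longleftrightarrow>
    (\<forall>\<rho>\<in>density. \<forall>\<sigma>\<in>density. \<exists>T :: real \<Rightarrow> 'n superop. (\<forall>t>0. T t \<in> \<O>) \<and>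
      ((\<exists>\<tau>>0. blinfun_apply (T \<tau>) \<rho> = \<sigma>) \<or> ((\<lambda>t. blinfun_apply (T t) \<rho>) \<longlongrightarrow> \<sigma>) at_top))"

end

theory Submission
  imports Defs
begin

text \<open>
  The unital channels form a closed convex set that is stable under composition. The generators lie
  in it: unitary conjugations clearly do, and for self-adjoint \<open>a\<close> the Lindblad operator \<open>L\<close> of \<open>a\<close> is
  trace-annihilating, kills the identity, and has completely positive exponentials. A unital
  map fixes the maximally mixed state, hence cannot move it to a pure state.
\<close>

section \<open>Exponentials of commuting operators\<close>

text \<open>A copy of the operators on a nontrivial space, as a normed algebra, so that the library's
  exponential function applies.\<close>

typedef (overloaded) 'a endo = "UNIV :: ('a::euclidean_space \<Rightarrow>\<^sub>L 'a) set"
  morphisms endo_blinfun Endo ..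

setup_lifting type_definition_endo

section \<open>Banach algebra structure on the copied operators\<close>

instantiation endo :: (euclidean_space) real_normed_vector
begin

lift_definition zero_endo :: "'a endo" is 0 .
lift_definition plus_endo :: "'a endo \<Rightarrow> 'a endo \<Rightarrow> 'a endo" is "(+)" .
lift_definition minus_endo :: "'a endo \<Rightarrow> 'a endo \<Rightarrow> 'a endo" is "(-)" .
lift_definition uminus_endo :: "'a endo \<Rightarrow> 'a endo" is uminus .
lift_definition scaleR_endo :: "real \<Rightarrow> 'a endo \<Rightarrow> 'a endo" is "(*\<^sub>R)" .
lift_definition norm_endo :: "'a endo \<Rightarrow> real" is norm .

definition dist_endo :: "'a endo \<Rightarrow> 'a endo \<Rightarrow> real"
  where "dist_endo x y = norm (x - y)"
definition sgn_endo :: "'a endo \<Rightarrow> 'a endo"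
  where "sgn_endo x = inverse (norm x) *\<^sub>R x"
definition uniformity_endo :: "('a endo \<times> 'a endo) filter"
  where "uniformity_endo = (INF e\<in>{0<..}. principal {(x, y). dist x y < e})"
definition open_endo :: "'a endo set \<Rightarrow> bool"
  where "open_endo U \<longleftrightarrow> (\<forall>x\<in>U. eventually (\<lambda>(x', y). x' = x \<longrightarrow> y \<in> U) uniformity)"

instance
proof
  fix x y z :: "'a endo" and a b :: real
  show "x + y + z = x + (y + z)" by transfer simp
  show "x + y = y + x" by transfer simp
  show "0 + x = x" by transfer simp
  show "- x + x = 0" by transfer simp
  show "x - y = x + - y" by transfer simp
  show "a *\<^sub>R (x + y) = a *\<^sub>R x + a *\<^sub>R y" by transfer (rule scaleR_add_right)
  show "(a + b) *\<^sub>R x = a *\<^sub>R x + b *\<^sub>R x" by transfer (rule scaleR_add_left)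
  show "a *\<^sub>R b *\<^sub>R x = (a * b) *\<^sub>R x" by transfer simp
  show "1 *\<^sub>R x = x" by transfer simp
  show "norm x = 0 \<longleftrightarrow> x = 0" by transfer simp
  show "norm (x + y) \<le> norm x + norm y" by transfer (rule norm_triangle_ineq)
  show "norm (a *\<^sub>R x) = \<bar>a\<bar> * norm x" by transfer simp
qed (simp_all add: dist_endo_def sgn_endo_def uniformity_endo_def open_endo_def)

end

instantiation endo :: (euclidean_space) real_normed_algebra_1
begin

lift_definition one_endo :: "'a endo" is id_blinfun .
lift_definition times_endo :: "'a endo \<Rightarrow> 'a endo \<Rightarrow> 'a endo" is "(o\<^sub>L)" .

instance
proof
  fix x y z :: "'a endo" and a :: real
  show "x * y * z = x * (y * z)" by transfer (simp add: blinfun_eqI)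
  show "1 * x = x" "x * 1 = x" by (transfer, simp add: blinfun_eqI)+
  show "(x + y) * z = x * z + y * z"
    by transfer (rule bounded_bilinear.add_left[OF bounded_bilinear_blinfun_compose])
  show "x * (y + z) = x * y + x * z"
    by transfer (rule bounded_bilinear.add_right[OF bounded_bilinear_blinfun_compose])
  show "a *\<^sub>R x * y = a *\<^sub>R (x * y)"
    by transfer (rule bounded_bilinear.scaleR_left[OF bounded_bilinear_blinfun_compose])
  show "x * a *\<^sub>R y = a *\<^sub>R (x * y)"
    by transfer (rule bounded_bilinear.scaleR_right[OF bounded_bilinear_blinfun_compose])
  \<comment> \<open>The identity has norm 1 because a Euclidean space contains a nonzero vector; on
    the zero space the norm would be 0.\<close>
  show "norm (1 :: 'a endo) = 1" by transfer simp
  then show "(0 :: 'a endo) \<noteq> 1" by (metis norm_zero zero_neq_one)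
  show "norm (x * y) \<le> norm x * norm y" by transfer (rule norm_blinfun_compose)
qed

end

lemma bounded_linear_endo_blinfun: "bounded_linear endo_blinfun"
  by (rule bounded_linear_intro[where K = 1]; transfer) simp_all

lemma bounded_linear_Endo: "bounded_linear Endo"
  by (rule bounded_linear_intro[where K = 1])
    (simp_all add: plus_endo.abs_eq scaleR_endo.abs_eq norm_endo.abs_eq)

instance endo :: (euclidean_space) banach
proof
  fix X :: "nat \<Rightarrow> 'a endo"
  assume "Cauchy X"
  then have "Cauchy (\<lambda>n. endo_blinfun (X n))"
    by (rule bounded_linear.Cauchy[OF bounded_linear_endo_blinfun])
  then obtain L where "(\<lambda>n. endo_blinfun (X n)) \<longlonglongrightarrow> L"
    using Cauchy_convergent convergent_def by blast
  then have "(\<lambda>n. Endo (endo_blinfun (X n))) \<longlonglongrightarrow> Endo L"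
    by (rule bounded_linear.tendsto[OF bounded_linear_Endo])
  then show "convergent X"
    by (auto simp: endo_blinfun_inverse convergent_def)
qed

text \<open>Powers in \<open>endo\<close> are iterated compositions, and the bounded linear
  \<open>endo_blinfun\<close> passes through the convergent series. This opens the way to
  \<open>exp_add_commuting\<close>.\<close>

lemma blinfun_exp_eq_exp:
  fixes F :: "'a::euclidean_space \<Rightarrow>\<^sub>L 'a"
  shows "blinfun_exp F = endo_blinfun (exp (Endo F))"
proof -
  have pow: "endo_blinfun (Endo F ^ k) = ((o\<^sub>L) F ^^ k) id_blinfun" for k
    by (induction k) (simp_all add: one_endo.rep_eq times_endo.rep_eq Endo_inverse)
  have "endo_blinfun (exp (Endo F)) = (\<Sum>k. endo_blinfun (Endo F ^ k /\<^sub>R fact k))"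
    unfolding exp_def
    by (rule bounded_linear.suminf[OF bounded_linear_endo_blinfun summable_exp_generic])
  then show ?thesis
    by (simp add: blinfun_exp_def scaleR_endo.rep_eq pow inverse_eq_divide)
qed

lemma blinfun_exp_add_commuting:
  fixes F G :: "'a::euclidean_space \<Rightarrow>\<^sub>L 'a"
  assumes "F o\<^sub>L G = G o\<^sub>L F"
  shows "blinfun_exp (F + G) = blinfun_exp F o\<^sub>L blinfun_exp G"
  using assms
  by (simp add: blinfun_exp_eq_exp plus_endo.abs_eq[symmetric] times_endo.abs_eq
      times_endo.rep_eq[symmetric] exp_add_commuting)

lemma blinfun_exp_0: "blinfun_exp (0 :: 'a::euclidean_space \<Rightarrow>\<^sub>L 'a) = id_blinfun"
  by (simp add: blinfun_exp_eq_exp zero_endo_def[symmetric] one_endo.rep_eq)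

section \<open>Properties read off the exponential series\<close>

lemma blinfun_exp_sums:
  "(\<lambda>k. (1 / fact k) *\<^sub>R ((o\<^sub>L) F ^^ k) id_blinfun) sums blinfun_exp F"
  unfolding blinfun_exp_def by (rule summable_sums[OF summable_blinfun_exp])

lemma blinfun_exp_apply_sums:
  "(\<lambda>k. (1 / fact k) *\<^sub>R blinfun_apply (((o\<^sub>L) F ^^ k) id_blinfun) x) sums blinfun_apply (blinfun_exp F) x"
  using bounded_linear.sums[OF blinfun.bounded_linear_left blinfun_exp_sums[of F], of x]
  by (simp add: scaleR_blinfun.rep_eq)

text \<open>The partial sums are nonnegative combinations of powers of \<open>F\<close>, hence lie
  in the cone, and closedness admits their limit. The cones in question are the complex linear and
  the completely positive maps.\<close>

lemma blinfun_exp_mem_closed_cone: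
  fixes F :: "'a::banach \<Rightarrow>\<^sub>L 'a"
  assumes "closed C" and "id_blinfun \<in> C" and "F \<in> C"
    and comp: "\<And>G H. G \<in> C \<Longrightarrow> H \<in> C \<Longrightarrow> G o\<^sub>L H \<in> C"
    and add: "\<And>G H. G \<in> C \<Longrightarrow> H \<in> C \<Longrightarrow> G + H \<in> C"
    and scale: "\<And>r G. r \<ge> 0 \<Longrightarrow> G \<in> C \<Longrightarrow> r *\<^sub>R G \<in> C"
  shows "blinfun_exp F \<in> C"
proof -
  have "((o\<^sub>L) F ^^ k) id_blinfun \<in> C" for k
    by (induction k) (simp_all add: assms)
  then have term_mem: "(1 / fact k) *\<^sub>R ((o\<^sub>L) F ^^ k) id_blinfun \<in> C" for k
    by (simp add: scale)
  have zero: "0 \<in> C"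
    using scale[of 0 id_blinfun] \<open>id_blinfun \<in> C\<close> by simp
  have "(\<Sum>k<n. (1 / fact k) *\<^sub>R ((o\<^sub>L) F ^^ k) id_blinfun) \<in> C" for n
    by (induction n) (simp_all add: zero add term_mem)
  then show ?thesis
    using blinfun_exp_sums[of F] unfolding sums_def by (rule closed_sequentially[OF \<open>closed C\<close>])
qed

text \<open>In each term with \<open>k > 0\<close> the outermost factor is \<open>F\<close>, so
  \<open>f\<close> annihilates it and only the term \<open>k = 0\<close> survives. With
  \<open>f\<close> the trace this yields trace preservation.\<close>

lemma bounded_linear_blinfun_exp_invariant:
  assumes "bounded_linear f" and "\<And>x. f (blinfun_apply F x) = 0"
  shows "f (blinfun_apply (blinfun_exp F) x) = f x"
proof -
  interpret f: bounded_linear f by fact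
  have "f ((1 / fact k) *\<^sub>R blinfun_apply (((o\<^sub>L) F ^^ k) id_blinfun) x) = 0" if "k > 0" for k
    using that by (cases k) (simp_all add: f.scaleR assms(2))
  then have "(\<lambda>k. f ((1 / fact k) *\<^sub>R blinfun_apply (((o\<^sub>L) F ^^ k) id_blinfun) x)) sums f x"
    using sums_finite[of "{0}" "\<lambda>k. f ((1 / fact k) *\<^sub>R blinfun_apply (((o\<^sub>L) F ^^ k) id_blinfun) x)"]
    by auto
  then show ?thesis
    using f.sums[OF blinfun_exp_apply_sums] sums_unique2 by blast
qed

text \<open>Here it is the innermost factor that vanishes: all terms with \<open>k > 0\<close> send
  \<open>x\<close> to 0. With \<open>x\<close> the identity matrix this yields unitality.\<close>

lemma blinfun_exp_apply_kernel:
  assumes "blinfun_apply F x = 0"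
  shows "blinfun_apply (blinfun_exp F) x = x"
proof -
  have pow: "blinfun_apply (((o\<^sub>L) F ^^ Suc k) id_blinfun) x = 0" for k
    by (induction k) (simp_all add: assms blinfun.zero_right)
  have "(1 / fact k) *\<^sub>R blinfun_apply (((o\<^sub>L) F ^^ k) id_blinfun) x = 0" if "k > 0" for k
    using that pow by (cases k) auto
  then have "(\<lambda>k. (1 / fact k) *\<^sub>R blinfun_apply (((o\<^sub>L) F ^^ k) id_blinfun) x) sums x"
    using sums_finite[of "{0}" "\<lambda>k. (1 / fact k) *\<^sub>R blinfun_apply (((o\<^sub>L) F ^^ k) id_blinfun) x"]
    by auto
  then show ?thesis
    using blinfun_exp_apply_sums sums_unique2 by blast
qed

section \<open>Matrix exponentials\<close>

lemma hadj_mult: "hadj (A ** B) = hadj B ** hadj A"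
  by (simp add: hadj_def matrix_matrix_mult_def vec_eq_iff mult.commute)

lemma hadj_mat_1 [simp]: "hadj (mat 1) = mat 1"
  by (simp add: hadj_def mat_def vec_eq_iff)

lemma hadj_scaleR: "hadj (r *\<^sub>R A) = r *\<^sub>R hadj A"
  by (simp add: hadj_def vec_eq_iff)

lemma scaleR_matrix_mult: "(r *\<^sub>R A) ** B = r *\<^sub>R (A ** B)"
  and matrix_mult_scaleR: "A ** (r *\<^sub>R B) = r *\<^sub>R (A ** B)" for A :: "'n::finite cmat"
  by (simp_all add: matrix_matrix_mult_def vec_eq_iff scaleR_sum_right)

lemma bounded_linear_hadj: "bounded_linear (hadj :: 'n::finite cmat \<Rightarrow> 'n cmat)"
proof -
  have "linear (hadj :: 'n cmat \<Rightarrow> 'n cmat)"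
    by (rule linearI) (simp_all add: hadj_def vec_eq_iff)
  then show ?thesis
    by (simp add: linear_conv_bounded_linear)
qed

text \<open>The iteration builds powers by multiplying from the left; adjoints and right
  multiplications produce the new factor on the right and need this exchange.\<close>

lemma matrix_power_commute: "((**) A ^^ k) (mat 1) ** A = A ** ((**) A ^^ k) (mat 1)"
  for A :: "'n::finite cmat"
  by (induction k) (simp_all add: matrix_mul_assoc[symmetric])

lemma mat_exp_sums: "(\<lambda>k. (1 / fact k) *\<^sub>R ((**) A ^^ k) (mat 1)) sums mat_exp A"
  unfolding mat_exp_def by (rule summable_sums[OF summable_mat_exp])

lemma hadj_mat_exp: "hadj (mat_exp A) = mat_exp (hadj A)"
proof -
  have "hadj (((**) A ^^ k) (mat 1)) = ((**) (hadj A) ^^ k) (mat 1)" for k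
    by (induction k) (simp_all add: hadj_mult matrix_power_commute)
  then have "(\<lambda>k. (1 / fact k) *\<^sub>R ((**) (hadj A) ^^ k) (mat 1)) sums hadj (mat_exp A)"
    using bounded_linear.sums[OF bounded_linear_hadj mat_exp_sums[of A]] by (simp add: hadj_scaleR)
  then show ?thesis
    using mat_exp_sums sums_unique2 by blast
qed

text \<open>Powers of a left multiplication are left multiplications by powers, so the two series
  agree at every \<open>X\<close>. This and its right-hand analogue carry the addition law for
  operators over to matrices.\<close>

lemma blinfun_exp_left_mult:
  fixes A :: "'n::finite cmat"
  shows "blinfun_exp (sandwich A (mat 1)) = sandwich (mat_exp A) (mat 1)"
proof (rule blinfun_eqI)
  fix X :: "'n cmat"
  have pow: "blinfun_apply (((o\<^sub>L) (sandwich A (mat 1)) ^^ k) id_blinfun) X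
      = ((**) A ^^ k) (mat 1) ** X" for k
    by (induction k) (simp_all add: sandwich.rep_eq matrix_mul_assoc)
  have bl: "bounded_linear (\<lambda>M :: 'n cmat. M ** X)"
    using bounded_linear_sandwich[of "mat 1" X] by simp
  have "(\<lambda>k. ((1 / fact k) *\<^sub>R ((**) A ^^ k) (mat 1)) ** X) sums (mat_exp A ** X)"
    by (rule bounded_linear.sums[OF bl mat_exp_sums])
  then have "(\<lambda>k. (1 / fact k) *\<^sub>R blinfun_apply (((o\<^sub>L) (sandwich A (mat 1)) ^^ k) id_blinfun) X)
      sums (mat_exp A ** X)"
    by (simp add: pow scaleR_matrix_mult matrix_mult_scaleR)
  then have "blinfun_apply (blinfun_exp (sandwich A (mat 1))) X = mat_exp A ** X"
    by (rule sums_unique2[OF blinfun_exp_apply_sums])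
  then show "blinfun_apply (blinfun_exp (sandwich A (mat 1))) X = blinfun_apply (sandwich (mat_exp A) (mat 1)) X"
    by (simp add: sandwich.rep_eq)
qed

lemma blinfun_exp_right_mult:
  fixes A :: "'n::finite cmat"
  shows "blinfun_exp (sandwich (mat 1) A) = sandwich (mat 1) (mat_exp A)"
proof (rule blinfun_eqI)
  fix X :: "'n cmat"
  have pow: "blinfun_apply (((o\<^sub>L) (sandwich (mat 1) A) ^^ k) id_blinfun) X
      = X ** ((**) A ^^ k) (mat 1)" for k
    by (induction k) (simp_all add: sandwich.rep_eq matrix_mul_assoc[symmetric] matrix_power_commute)
  have bl: "bounded_linear (\<lambda>M :: 'n cmat. X ** M)"
    using bounded_linear_sandwich[of X "mat 1"] by simp
  have "(\<lambda>k. X ** ((1 / fact k) *\<^sub>R ((**) A ^^ k) (mat 1))) sums (X ** mat_exp A)"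
    by (rule bounded_linear.sums[OF bl mat_exp_sums])
  then have "(\<lambda>k. (1 / fact k) *\<^sub>R blinfun_apply (((o\<^sub>L) (sandwich (mat 1) A) ^^ k) id_blinfun) X)
      sums (X ** mat_exp A)"
    by (simp add: pow scaleR_matrix_mult matrix_mult_scaleR)
  then have "blinfun_apply (blinfun_exp (sandwich (mat 1) A)) X = X ** mat_exp A"
    by (rule sums_unique2[OF blinfun_exp_apply_sums])
  then show "blinfun_apply (blinfun_exp (sandwich (mat 1) A)) X = blinfun_apply (sandwich (mat 1) (mat_exp A)) X"
    by (simp add: sandwich.rep_eq)
qed

lemma sandwich_comp: "sandwich A B o\<^sub>L sandwich C D = sandwich (A ** C) (D ** B)"
  by (rule blinfun_eqI) (simp add: sandwich.rep_eq matrix_mul_assoc)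

text \<open>Left multiplications by \<open>A\<close> and \<open>- A\<close> commute and add up to 0,
  so the exponentials of these operators compose to the identity; evaluation at \<open>mat 1\<close>
  gives the matrix equation.\<close>

lemma mat_exp_mult_minus: "mat_exp A ** mat_exp (- A) = mat 1"
proof -
  let ?L = "\<lambda>A. sandwich A (mat 1)"
  have L0: "?L A + ?L (- A) = 0"
    by (rule blinfun_eqI)
      (simp add: sandwich.rep_eq plus_blinfun.rep_eq vec_eq_iff matrix_matrix_mult_def
        sum_negf)
  have comm: "?L A o\<^sub>L ?L (- A) = ?L (- A) o\<^sub>L ?L A"
    by (simp add: sandwich_comp) (simp add: matrix_matrix_mult_def)
  have "?L (mat_exp A) o\<^sub>L ?L (mat_exp (- A)) = id_blinfun"
    using blinfun_exp_add_commuting[OF comm] by (simp add: L0 blinfun_exp_0 blinfun_exp_left_mult)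
  then have "blinfun_apply (?L (mat_exp A) o\<^sub>L ?L (mat_exp (- A))) (mat 1) = mat 1"
    by simp
  then show ?thesis
    by (simp add: sandwich.rep_eq)
qed

section \<open>Unital channels\<close>

text \<open>Elements of \<open>superop\<close> are only real linear, so the first clause of
  \<open>channel\<close> gets a name of its own and is carried through the closed cone
  argument.\<close>

definition complex_linear :: "'n::finite superop \<Rightarrow> bool"
  where "complex_linear \<Phi> \<longleftrightarrow>
    (\<forall>c A. blinfun_apply \<Phi> (cscale c A) = cscale c (blinfun_apply \<Phi> A))"

lemma channel_iff:
  "channel \<Phi> \<longleftrightarrow> complex_linear \<Phi> \<and> completely_positive \<Phi> \<and>
    (\<forall>A. trace (blinfun_apply \<Phi> A) = trace A)"
  by (simp add: channel_def complex_linear_def)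

lemma cscale_add: "cscale c (A + B) = cscale c A + cscale c B"
  and cscale_scaleR: "cscale c (r *\<^sub>R A) = r *\<^sub>R cscale c A"
  and trace_scaleR: "trace (r *\<^sub>R A) = r *\<^sub>R trace A" for A :: "'n::finite cmat"
  by (simp_all add: cscale_def trace_def vec_eq_iff algebra_simps scaleR_sum_right)

lemma cinner_add_right: "cinner v (w + w') = cinner v w + cinner v w'"
  and cinner_scaleR_right: "cinner v (r *\<^sub>R w) = r *\<^sub>R cinner v w"
  by (simp_all add: cinner_def algebra_simps sum.distrib scaleR_sum_right)

lemma scaleR_matrix_vector: "(r *\<^sub>R A) *v v = r *\<^sub>R (A *v v)"
  for A :: "'n::finite cmat"
  by (simp add: matrix_vector_mult_def vec_eq_iff scaleR_sum_right)

lemma cinner_matrix: "cinner v (A *v w) = cinner (hadj A *v v) w"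
  by (simp add: cinner_def hadj_def matrix_vector_mult_def sum_distrib_left sum_distrib_right
      cnj_sum mult_ac) (rule sum.swap)

section \<open>Complex linear maps and completely positive maps as closed cones\<close>

lemma complex_linear_id: "complex_linear id_blinfun"
  and complex_linear_comp: "complex_linear \<Phi> \<Longrightarrow> complex_linear \<Psi> \<Longrightarrow> complex_linear (\<Phi> o\<^sub>L \<Psi>)"
  and complex_linear_add: "complex_linear \<Phi> \<Longrightarrow> complex_linear \<Psi> \<Longrightarrow> complex_linear (\<Phi> + \<Psi>)"
  and complex_linear_scaleR: "complex_linear \<Phi> \<Longrightarrow> complex_linear (r *\<^sub>R \<Phi>)"
  by (simp_all add: complex_linear_def plus_blinfun.rep_eq scaleR_blinfun.rep_eq
      cscale_add cscale_scaleR)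

lemma closed_complex_linear: "closed {\<Phi> :: 'n::finite superop. complex_linear \<Phi>}"
  unfolding complex_linear_def cscale_def
  by (intro closed_Collect_all closed_Collect_eq continuous_intros)

lemma complex_linear_sandwich: "complex_linear (sandwich A B)"
  by (simp add: complex_linear_def sandwich.rep_eq cscale_def matrix_matrix_mult_def vec_eq_iff
      sum_distrib_left sum_distrib_right mult_ac)

lemma completely_positive_id: "completely_positive id_blinfun"
  and completely_positive_comp:
    "completely_positive \<Phi> \<Longrightarrow> completely_positive \<Psi> \<Longrightarrow> completely_positive (\<Phi> o\<^sub>L \<Psi>)"
  by (simp_all add: completely_positive_def)

lemma completely_positive_add:
  assumes "completely_positive \<Phi>" and "completely_positive \<Psi>"
  shows "completely_positive (\<Phi> + \<Psi>)"
  using assms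
  by (simp add: completely_positive_def block_pos_semidef_def plus_blinfun.rep_eq
      matrix_vector_mult_add_rdistrib cinner_add_right sum.distrib)

lemma completely_positive_scaleR:
  assumes "completely_positive \<Phi>" and "r \<ge> 0"
  shows "completely_positive (r *\<^sub>R \<Phi>)"
  using assms
  by (simp add: completely_positive_def block_pos_semidef_def scaleR_blinfun.rep_eq
      scaleR_matrix_vector cinner_scaleR_right flip: scaleR_sum_right)
    (simp add: scaleR_conv_of_real)

lemma closed_completely_positive: "closed {\<Phi> :: 'n::finite superop. completely_positive \<Phi>}"
proof -
  have "closed {\<Phi> :: 'n superop. (\<Sum>i<m. \<Sum>j<m. cinner (v i) (blinfun_apply \<Phi> (X i j) *v v j)) \<in> \<real>\<^sub>\<ge>\<^sub>0}"
    for m :: nat and v X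
  proof -
    let ?f = "\<lambda>\<Phi> :: 'n superop. \<Sum>i<m. \<Sum>j<m. cinner (v i) (blinfun_apply \<Phi> (X i j) *v v j)"
    have "isCont ?f \<Phi>" for \<Phi>
      unfolding cinner_def matrix_vector_mult_def by (simp, intro continuous_intros)
    then have "closed (?f -` \<real>\<^sub>\<ge>\<^sub>0)"
      by (intro continuous_closed_vimage closed_nonneg_Reals_complex)
    then show ?thesis
      by (simp add: vimage_def)
  qed
  then show ?thesis
    unfolding completely_positive_def block_pos_semidef_def
    \<comment> \<open>The premise on \<open>X\<close> does not mention \<Phi>, so the set it defines
      is trivially open, as the rule for implications demands.\<close>
    by (intro closed_Collect_all closed_Collect_imp) simp_all
qed

text \<open>Moving the outer \<open>A\<close> across the inner product turns the form of the image
  at \<open>v\<close> into the form of \<open>X\<close> at the vectors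
  \<open>hadj A *v v i\<close>.\<close>

lemma completely_positive_conjugation: "completely_positive (sandwich A (hadj A))"
  unfolding completely_positive_def block_pos_semidef_def
proof (intro allI impI)
  fix m :: nat and X :: "nat \<Rightarrow> nat \<Rightarrow> 'a cmat" and v :: "nat \<Rightarrow> complex ^ 'a"
  assume "\<forall>v. (\<Sum>i<m. \<Sum>j<m. cinner (v i) (X i j *v v j)) \<in> \<real>\<^sub>\<ge>\<^sub>0"
  from this[rule_format, of "\<lambda>i. hadj A *v v i"]
  show "(\<Sum>i<m. \<Sum>j<m. cinner (v i) (blinfun_apply (sandwich A (hadj A)) (X i j) *v v j)) \<in> \<real>\<^sub>\<ge>\<^sub>0"
    by (simp add: sandwich.rep_eq cinner_matrix[of _ A] flip: matrix_vector_mul_assoc)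
qed

text \<open>The two unitarity equations act separately: \<open>hadj U ** U = mat 1\<close> preserves
  the trace by cyclicity, \<open>U ** hadj U = mat 1\<close> preserves the identity.\<close>

lemma unital_channel_unitary_conjugation:
  assumes "U ** hadj U = mat 1" and "hadj U ** U = mat 1"
  shows "channel (sandwich U (hadj U))" and "unital (sandwich U (hadj U))"
proof -
  have "trace (U ** A ** hadj U) = trace A" for A
    using assms(2) by (metis trace_mul_sym matrix_mul_assoc matrix_mul_lid)
  then show "channel (sandwich U (hadj U))"
    by (simp add: channel_iff complex_linear_sandwich completely_positive_conjugation sandwich.rep_eq)
  show "unital (sandwich U (hadj U))"
    by (simp add: unital_def sandwich.rep_eq assms)
qed

text \<open>The exponent \<open>B\<close> is anti-Hermitian, so \<open>mat_exp (- B)\<close> is both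
  the inverse and the adjoint of \<open>mat_exp B\<close>; the map is a unitary conjugation.\<close>

lemma unital_channel_hamiltonian:
  fixes t :: real
  assumes "hadj (cscale \<i> H) = - cscale \<i> H"
  defines "\<Phi> \<equiv> sandwich (mat_exp (cscale (\<i> * of_real t) H)) (mat_exp (cscale (- \<i> * of_real t) H))"
  shows "channel \<Phi>" and "unital \<Phi>"
proof -
  define B where "B = cscale (\<i> * of_real t) H"
  have "B = t *\<^sub>R cscale \<i> H"
    by (simp add: B_def cscale_def vec_eq_iff) (simp add: scaleR_conv_of_real)
  then have adj: "hadj B = - B"
    by (simp add: hadj_scaleR assms(1))
  have minus: "cscale (- \<i> * of_real t) H = - B"
    by (simp add: B_def cscale_def vec_eq_iff)
  have adj_exp: "mat_exp (- B) = hadj (mat_exp B)"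
    by (simp add: hadj_mat_exp adj)
  have "mat_exp B ** hadj (mat_exp B) = mat 1" "hadj (mat_exp B) ** mat_exp B = mat 1"
    using mat_exp_mult_minus[of B] mat_exp_mult_minus[of "- B"] by (simp_all add: adj_exp)
  from unital_channel_unitary_conjugation[OF this]
  show "channel \<Phi>" "unital \<Phi>"
    unfolding \<Phi>_def minus B_def[symmetric] adj_exp .
qed

text \<open>For self-adjoint \<open>a\<close> the jump term \<open>2 a \<rho> a\<close> commutes with the damping terms, so
  \<open>exp (t L)\<close> splits into the exponential of a completely positive map and a conjugation.\<close>

lemma completely_positive_exp_lindblad:
  assumes a: "hadj a = a" and t: "t \<ge> 0"
  shows "completely_positive (blinfun_exp (t *\<^sub>R lindblad a))"
proof -
  define J where "J = (2 * t) *\<^sub>R sandwich a a"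
  \<comment> \<open>As \<open>a\<close> is self-adjoint, both damping terms are multiplications by
    this one matrix, once from the left and once from the right.\<close>
  define M where "M = (- t) *\<^sub>R (a ** a)"
  define E where "E = mat_exp M"
  have L: "t *\<^sub>R lindblad a = J + (sandwich M (mat 1) + sandwich (mat 1) M)"
    by (rule blinfun_eqI, simp add: J_def M_def lindblad.rep_eq sandwich.rep_eq plus_blinfun.rep_eq
        scaleR_blinfun.rep_eq a scaleR_matrix_mult matrix_mult_scaleR matrix_mul_assoc
        algebra_simps del: scaleR_minus_left)
      simp
  have Mcomm: "M ** a = a ** M"
    by (simp add: M_def scaleR_matrix_mult matrix_mult_scaleR matrix_mul_assoc del: scaleR_minus_left)
  have J_left: "J o\<^sub>L sandwich M (mat 1) = sandwich M (mat 1) o\<^sub>L J"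
    and J_right: "J o\<^sub>L sandwich (mat 1) M = sandwich (mat 1) M o\<^sub>L J"
    by (simp_all add: J_def sandwich_comp Mcomm
        bounded_bilinear.scaleR_left[OF bounded_bilinear_blinfun_compose]
        bounded_bilinear.scaleR_right[OF bounded_bilinear_blinfun_compose])
  have J_comm: "J o\<^sub>L (sandwich M (mat 1) + sandwich (mat 1) M)
      = (sandwich M (mat 1) + sandwich (mat 1) M) o\<^sub>L J"
    by (simp add: J_left J_right
        bounded_bilinear.add_left[OF bounded_bilinear_blinfun_compose]
        bounded_bilinear.add_right[OF bounded_bilinear_blinfun_compose])
  have LR_comm: "sandwich M (mat 1) o\<^sub>L sandwich (mat 1) M
      = sandwich (mat 1) M o\<^sub>L sandwich M (mat 1)"
    by (simp add: sandwich_comp)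
  have "hadj M = M"
    by (simp add: M_def hadj_scaleR hadj_mult a del: scaleR_minus_left)
  then have E: "hadj E = E"
    by (simp add: E_def hadj_mat_exp)
  \<comment> \<open>The left and right multiplications commute, and their exponentials combine to a
    sandwich between two copies of \<open>E\<close>; self-adjointness of \<open>E\<close> makes it a
    conjugation.\<close>
  have split: "blinfun_exp (t *\<^sub>R lindblad a) = blinfun_exp J o\<^sub>L sandwich E (hadj E)"
    unfolding L blinfun_exp_add_commuting[OF J_comm] blinfun_exp_add_commuting[OF LR_comm]
    by (simp add: blinfun_exp_left_mult blinfun_exp_right_mult sandwich_comp E flip: E_def)
  have "completely_positive J"
    using completely_positive_conjugation[of a] t unfolding J_def a
    by (intro completely_positive_scaleR) auto
  then have "blinfun_exp J \<in> {\<Phi>. completely_positive \<Phi>}"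
    by (intro blinfun_exp_mem_closed_cone closed_completely_positive)
      (simp_all add: completely_positive_id completely_positive_comp completely_positive_add
        completely_positive_scaleR)
  then show ?thesis
    unfolding split by (intro completely_positive_comp completely_positive_conjugation) simp
qed

section \<open>Lindblad evolutions as unital channels\<close>

lemma complex_linear_lindblad: "complex_linear (lindblad a)"
  by (simp add: complex_linear_def lindblad.rep_eq cscale_def matrix_matrix_mult_def vec_eq_iff
      sum_distrib_left sum_distrib_right scaleR_sum_right algebra_simps)

lemma bounded_linear_trace: "bounded_linear (trace :: 'n::finite cmat \<Rightarrow> complex)"
proof -
  have "linear (trace :: 'n cmat \<Rightarrow> complex)"
    by (rule linearI) (simp_all add: trace_add trace_scaleR)
  then show ?thesis
    by (simp add: linear_conv_bounded_linear)
qed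

text \<open>By cyclicity all three products have the same trace, and the coefficients 2, -1, -1
  cancel.\<close>

lemma trace_lindblad: "trace (blinfun_apply (lindblad a) \<rho>) = 0"
proof -
  have "trace (a ** \<rho> ** hadj a) = trace (hadj a ** a ** \<rho>)"
    by (metis trace_mul_sym matrix_mul_assoc)
  moreover have "trace (\<rho> ** hadj a ** a) = trace (hadj a ** a ** \<rho>)"
    by (metis trace_mul_sym matrix_mul_assoc)
  ultimately show ?thesis
    by (simp only: lindblad.rep_eq trace_sub trace_scaleR) (simp add: scaleR_conv_of_real)
qed

lemma unital_channel_exp_lindblad:
  assumes a: "hadj a = a" and t: "t \<ge> 0"
  shows "channel (blinfun_exp (t *\<^sub>R lindblad a))" and "unital (blinfun_exp (t *\<^sub>R lindblad a))"
proof -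
  have "blinfun_exp (t *\<^sub>R lindblad a) \<in> {\<Phi>. complex_linear \<Phi>}"
    by (intro blinfun_exp_mem_closed_cone closed_complex_linear)
      (simp_all add: complex_linear_id complex_linear_comp complex_linear_add
        complex_linear_scaleR complex_linear_lindblad)
  moreover have "trace (blinfun_apply (blinfun_exp (t *\<^sub>R lindblad a)) A) = trace A" for A
    by (rule bounded_linear_blinfun_exp_invariant[OF bounded_linear_trace])
      (simp add: scaleR_blinfun.rep_eq trace_scaleR trace_lindblad)
  ultimately show "channel (blinfun_exp (t *\<^sub>R lindblad a))"
    by (simp add: channel_iff completely_positive_exp_lindblad assms)
  \<comment> \<open>At the identity the generator is twice \<open>a ** hadj a - hadj a ** a\<close>,
    which vanishes for self-adjoint \<open>a\<close>.\<close>
  have "blinfun_apply (t *\<^sub>R lindblad a) (mat 1) = 0"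
    by (simp add: scaleR_blinfun.rep_eq lindblad.rep_eq a scaleR_2)
  then show "unital (blinfun_exp (t *\<^sub>R lindblad a))"
    unfolding unital_def by (rule blinfun_exp_apply_kernel)
qed

section \<open>The set of unital channels satisfies the generation rules\<close>

lemma closed_unital_channels: "closed {\<Phi> :: 'n::finite superop. channel \<Phi> \<and> unital \<Phi>}"
proof -
  have "closed {\<Phi> :: 'n superop. \<forall>A. trace (blinfun_apply \<Phi> A) = trace A}"
    unfolding trace_def by (intro closed_Collect_all closed_Collect_eq continuous_intros)
  moreover have "closed {\<Phi> :: 'n superop. unital \<Phi>}"
    unfolding unital_def by (intro closed_Collect_eq continuous_intros)
  ultimately show ?thesis
    unfolding channel_iff
    by (intro closed_Collect_conj closed_complex_linear closed_completely_positive)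
qed

text \<open>Nonnegative weights keep complete positivity; weights adding up to 1 keep the trace and
  the identity.\<close>

lemma convex_unital_channels: "convex {\<Phi> :: 'n::finite superop. channel \<Phi> \<and> unital \<Phi>}"
proof (rule convexI)
  fix \<Phi> \<Psi> :: "'n superop" and u v :: real
  assume "\<Phi> \<in> {\<Phi>. channel \<Phi> \<and> unital \<Phi>}" "\<Psi> \<in> {\<Phi>. channel \<Phi> \<and> unital \<Phi>}"
    and uv: "u \<ge> 0" "v \<ge> 0" "u + v = 1"
  then show "u *\<^sub>R \<Phi> + v *\<^sub>R \<Psi> \<in> {\<Phi>. channel \<Phi> \<and> unital \<Phi>}"
    by (simp add: channel_iff unital_def complex_linear_add complex_linear_scaleR
        completely_positive_add completely_positive_scaleR plus_blinfun.rep_eq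
        scaleR_blinfun.rep_eq trace_add trace_scaleR flip: scaleR_add_left)
qed

text \<open>The closure is an intersection over all families obeying the rules, so it suffices that
  the unital channels form one such family.\<close>

lemma Channel_closure_unital_channels:
  assumes "\<And>a. a \<in> S \<Longrightarrow> hadj a = a"
  shows "Channel_closure S \<subseteq> {\<Phi>. channel \<Phi> \<and> unital \<Phi>}"
proof -
  have comp: "channel (\<Phi> o\<^sub>L \<Psi>) \<and> unital (\<Phi> o\<^sub>L \<Psi>)"
    if "channel \<Phi> \<and> unital \<Phi>" "channel \<Psi> \<and> unital \<Psi>" for \<Phi> \<Psi> :: "'a superop"
    using that by (simp add: channel_iff unital_def complex_linear_comp completely_positive_comp)
  have "generation_rules S {\<Phi>. channel \<Phi> \<and> unital \<Phi>}"
    unfolding generation_rules_def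
    using assms unital_channel_hamiltonian unital_channel_exp_lindblad comp
      closed_unital_channels convex_unital_channels
    by blast
  then show ?thesis
    unfolding Channel_closure_def by blast
qed

section \<open>Failure of transitivity\<close>

lemma cinner_self: "cinner v v = of_real (\<Sum>i\<in>UNIV. (cmod (v $ i))\<^sup>2)"
  by (simp add: cinner_def complex_norm_square mult.commute del: of_real_power)

lemma maximally_mixed_density: "(1 / CARD('n)) *\<^sub>R (mat 1 :: 'n::finite cmat) \<in> density"
proof -
  have "cinner v (((1 / CARD('n)) *\<^sub>R mat 1) *v v)
      = of_real ((1 / CARD('n)) * (\<Sum>i\<in>UNIV. (cmod (v $ i))\<^sup>2))" for v :: "complex ^ 'n"
    by (simp only: scaleR_matrix_vector cinner_scaleR_right cinner_self matrix_vector_mul_lid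
        scaleR_conv_of_real[where 'a = complex] of_real_mult)
  then have "pos_semidef ((1 / CARD('n)) *\<^sub>R (mat 1 :: 'n cmat))"
    by (simp only: pos_semidef_def nonneg_Reals_of_real_iff) (simp add: sum_nonneg)
  then show ?thesis
    by (simp add: density_def hadj_scaleR trace_scaleR trace_I scaleR_conv_of_real[where 'a = complex])
qed

text \<open>The orthogonal projection onto the line of the \<open>k\<close>-th coordinate vector,
  that is, a pure state.\<close>

definition basis_proj :: "'n::finite \<Rightarrow> 'n cmat"
  where "basis_proj k = (\<chi> i j. if i = k \<and> j = k then 1 else 0)"

lemma basis_proj_density: "basis_proj k \<in> density"
proof -
  have mv: "basis_proj k *v v = (\<chi> i. if i = k then v $ k else 0)" for v
    by (simp add: basis_proj_def matrix_vector_mult_def vec_eq_iff if_distrib[of "\<lambda>x. x * _"]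
        cong: if_cong)
  have "cinner v (basis_proj k *v v) = of_real ((cmod (v $ k))\<^sup>2)" for v
    unfolding mv complex_norm_square
    by (simp add: cinner_def if_distrib[of "\<lambda>x. _ * x"] mult.commute cong: if_cong)
  then have "pos_semidef (basis_proj k)"
    unfolding pos_semidef_def by (simp del: of_real_power)
  moreover have "hadj (basis_proj k) = basis_proj k"
    by (simp add: hadj_def basis_proj_def vec_eq_iff)
  moreover have "trace (basis_proj k) = 1"
    by (simp add: trace_def basis_proj_def)
  ultimately show ?thesis
    by (simp add: density_def)
qed

text \<open>A second index \<open>l\<close> gives two diagonal entries, 1 at \<open>k\<close> and 0
  at \<open>l\<close>, whereas a multiple of the identity has a constant diagonal.\<close>

lemma basis_proj_neq_scaled_identity:
  assumes "CARD('n::finite) \<ge> 2"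
  shows "basis_proj (k :: 'n) \<noteq> r *\<^sub>R mat 1"
proof
  assume eq: "basis_proj k = r *\<^sub>R mat 1"
  obtain l :: 'n where "l \<noteq> k"
  proof -
    have "card {k} < CARD('n)" using assms by simp
    then have "UNIV \<noteq> {k}" by (metis less_irrefl)
    then show ?thesis using that by blast
  qed
  have "basis_proj k $ k $ k = of_real r" "basis_proj k $ l $ l = of_real r"
    unfolding eq by (simp_all add: mat_def scaleR_conv_of_real[where 'a = complex])
  then show False
    using \<open>l \<noteq> k\<close> by (simp add: basis_proj_def)
qed

theorem proposition2p7:
  fixes S :: "(complex ^ 'n::finite ^ 'n) set"
  assumes "\<And>a. a \<in> S \<Longrightarrow> hadj a = a"
  shows "(\<forall>\<Phi> \<in> Channel_closure S. channel \<Phi> \<and> unital \<Phi>) \<and>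
    (CARD('n) \<ge> 2 \<longrightarrow>
      \<not> transitive_ops (Channel_closure S) \<and> \<not> transitive_evolutions (Channel_closure S))"
proof (intro conjI impI)
  show channels: "\<forall>\<Phi> \<in> Channel_closure S. channel \<Phi> \<and> unital \<Phi>"
    using Channel_closure_unital_channels[OF assms] by blast
  \<comment> \<open>In dimension one \<open>mat 1\<close> is the only density matrix, so
    non-transitivity is claimed from dimension two on.\<close>
  assume card: "CARD('n) \<ge> 2"
  define \<rho> :: "'n cmat" where "\<rho> = (1 / CARD('n)) *\<^sub>R mat 1"
  \<comment> \<open>\<open>undefined\<close> stands for an arbitrary index; any pure basis state
    would do.\<close>
  define \<sigma> :: "'n cmat" where "\<sigma> = basis_proj undefined"
  have \<rho>: "\<rho> \<in> density" and \<sigma>: "\<sigma> \<in> density" and neq: "\<rho> \<noteq> \<sigma>"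
    using maximally_mixed_density basis_proj_density basis_proj_neq_scaled_identity[OF card]
    by (auto simp: \<rho>_def \<sigma>_def dest: sym)
  have fixed: "blinfun_apply \<Phi> \<rho> = \<rho>" if "\<Phi> \<in> Channel_closure S" for \<Phi>
    using channels that by (simp add: \<rho>_def unital_def blinfun.scaleR_right)
  show "\<not> transitive_ops (Channel_closure S)"
    using \<rho> \<sigma> neq fixed unfolding transitive_ops_def by metis
  show "\<not> transitive_evolutions (Channel_closure S)"
  proof
    assume "transitive_evolutions (Channel_closure S)"
    then obtain T :: "real \<Rightarrow> 'n superop" where T: "\<And>t. t > 0 \<Longrightarrow> T t \<in> Channel_closure S"
      and reach: "(\<exists>\<tau>>0. blinfun_apply (T \<tau>) \<rho> = \<sigma>) \<or> ((\<lambda>t. blinfun_apply (T t) \<rho>) \<longlongrightarrow> \<sigma>) at_top"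
      using \<rho> \<sigma> unfolding transitive_evolutions_def by metis
    have const: "blinfun_apply (T t) \<rho> = \<rho>" if "t > 0" for t
      using fixed T that by blast
    \<comment> \<open>The trajectory stays at \<rho> for positive times, so \<sigma> cannot be hit
      at a finite time and only the limit alternative remains. It fails by uniqueness of
      limits.\<close>
    then have "((\<lambda>t. blinfun_apply (T t) \<rho>) \<longlongrightarrow> \<sigma>) at_top"
      using reach neq by metis
    moreover have "((\<lambda>t. blinfun_apply (T t) \<rho>) \<longlongrightarrow> \<rho>) at_top"
      using const by (intro tendsto_eventually eventually_mono[OF eventually_gt_at_top[of 0]]) auto
    ultimately show False
      using neq tendsto_unique[OF trivial_limit_at_top_linorder] by blast
  qed
qed

end
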